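(* Let $\beta\in k^\times$, $X^*=\beta\cdot\sqrt\varpi\in\mathfrak t_\varpi^*$ (so $X^*$ is ramified), and let $s,\theta'\in k^\times$, $Y=s\cdot\sqrt{\theta'}\in\mathfrak t_{\theta'}$. If $\operatorname{depth}(X^* )+\operatorname{depth}(Y)<0$, then $M^G_{X^*}(Y)=0$ unless $X^*$ and $Y$ lie in $G$-conjugate tori.
   Context: $k$ is a non-discrete non-Archimedean local field of residual characteristic $\ne 2$, with ring of integers $\mathcal O$, maximal ideal $\mathfrak p$, valuation $\operatorname{ord}$ with value group $\mathbb Z$, residue field of order $q$, $|x|=q^{-\operatorname{ord}(x)}$; $\varpi$ is a uniformiser. $dx$ (or $dt$) is the Haar measure on $k$ giving $\mathcal O$ measure $1$, and $d^\times x=|x|^{-1}dx$. $\Phi$ is a non-trivial additive character of $k$. $k_\varpi=k(\sqrt\varpi)$ and $N_\varpi(a+b\sqrt\varpi)=a^2-b^2\varpi$. $G=\mathrm{SL}_2(k)$, $\mathfrak g=\mathfrak{sl}_2(k)$ with dual $\mathfrak g^*$ and pairing $\langle\cdot,\cdot\rangle$. For $\theta\in k^\times$, $\mathbf T_\theta=\{\begin{pmatrix}a&b\\ b\theta&a\end{pmatrix}:a^2-b^2\theta=1\}$, with Lie algebra $\mathfrak t_\theta=k\cdot\sqrt\theta$, where here $\sqrt\theta$ denotes the matrix $\begin{pmatrix}0&1\\ \theta&0\end{pmatrix}$. $X^*=\beta\sqrt\varpi$ means the functional $Z\mapsto\mathrm{Tr}(\beta\sqrt\varpi Z)$ on $\mathfrak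 g$. $X^*$ lies in $\mathbf T_\varpi$ (its centraliser) and $Y$ lies in $\mathbf T_{\theta'}$. Depth: $\operatorname{depth}(c\sqrt\theta)=\tfrac12\operatorname{ord}(c^2\theta)$ for $c\sqrt\theta\in\mathfrak t_\theta$; $\operatorname{depth}(X^* )$ is the largest real $\rho$ such that $\Phi(\langle X^*,Z\rangle)=1$ for all $Z\in\mathfrak t_\varpi$ with $\operatorname{depth}(Z)>-\rho$. Mock Fourier transform: $$M^G_{X^*}(Y)=\sum_{n\in\mathbb Z}\int_{\operatorname{ord}(x)=n}\mathbf 1_{N_\varpi(k_\varpi^\times)}(x)\Bigl(\sum_{l\in\mathbb Z}\int_{\operatorname{ord}(t)=l}\Phi\bigl(\beta s(x\theta'+x^{-1}\varpi-x^{-1}t^2)\bigr)\,dt\Bigr)d^\times x,$$ where $\mathbf 1_S$ is the characteristic function of $S$. *)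

theory Defs
  imports "HOL-Analysis.Analysis"
begin

section \<open>Non-Archimedean local fields\<close>

text \<open>
  A valuation is a function \<open>ord\<close> into the integers that is only meaningful on non-zero
  arguments; every use of it below treats \<open>0\<close>, whose valuation is infinite, separately.
\<close>

definition ext_ord :: "('k::field \<Rightarrow> int) \<Rightarrow> 'k \<Rightarrow> ereal" where
  "ext_ord ord x = (if x = 0 then \<infinity> else ereal (of_int (ord x)))"

definition ring_of_integers :: "('k::field \<Rightarrow> int) \<Rightarrow> 'k set" where
  "ring_of_integers ord = {x. ext_ord ord x \<ge> 0}"

definition max_ideal :: "('k::field \<Rightarrow> int) \<Rightarrow> 'k set" where
  "max_ideal ord = {x. ext_ord ord x > 0}"

definition residue_field :: "('k::field \<Rightarrow> int) \<Rightarrow> 'k set set" where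
  "residue_field ord = ring_of_integers ord //
     {(x, y). x \<in> ring_of_integers ord \<and> y \<in> ring_of_integers ord \<and> x - y \<in> max_ideal ord}"

definition residue_order :: "('k::field \<Rightarrow> int) \<Rightarrow> nat" where
  "residue_order ord = card (residue_field ord)"

text \<open>
  The characteristic of the residue field, computed upstairs; this follows the library's
  definition of \<open>CHAR\<close> as the gcd of the natural numbers whose image is zero.
\<close>

definition residue_char :: "('k::field \<Rightarrow> int) \<Rightarrow> nat" where
  "residue_char ord = Gcd {n. of_nat n \<in> max_ideal ord}"

definition abs_val :: "('k::field \<Rightarrow> int) \<Rightarrow> 'k \<Rightarrow> real" where
  "abs_val ord x = (if x = 0 then 0 else real (residue_order ord) powi (- ord x))"

text \<open>
  The topology of the field is the one of its type; it is tied to the valuation by requiring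
  that the distance is the one of the normalised absolute value.
\<close>

locale nonarch_local_field =
  fixes ord :: "'k::{field, metric_space} \<Rightarrow> int"
  assumes ord_mult: "\<And>x y. x \<noteq> 0 \<Longrightarrow> y \<noteq> 0 \<Longrightarrow> ord (x * y) = ord x + ord y"
    and ord_add: "\<And>x y. x \<noteq> 0 \<Longrightarrow> y \<noteq> 0 \<Longrightarrow> x + y \<noteq> 0 \<Longrightarrow> ord (x + y) \<ge> min (ord x) (ord y)"
    and ord_surj: "ord ` (UNIV - {0}) = UNIV"
    and finite_residue_field: "finite (residue_field ord)"
    and dist_abs_val: "\<And>x y. dist x y = abs_val ord (x - y)"
    and complete_UNIV: "complete (UNIV :: 'k set)"

definition uniformiser :: "('k::field \<Rightarrow> int) \<Rightarrow> 'k \<Rightarrow> bool" where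
  "uniformiser ord w \<longleftrightarrow> w \<noteq> 0 \<and> ord w = 1"

definition add_char :: "('k::{field, metric_space} \<Rightarrow> complex) \<Rightarrow> bool" where
  "add_char \<Phi> \<longleftrightarrow> continuous_on UNIV \<Phi> \<and> (\<forall>x. norm (\<Phi> x) = 1) \<and> (\<forall>x y. \<Phi> (x + y) = \<Phi> x * \<Phi> y)"

definition nontrivial_add_char :: "('k::{field, metric_space} \<Rightarrow> complex) \<Rightarrow> bool" where
  "nontrivial_add_char \<Phi> \<longleftrightarrow> add_char \<Phi> \<and> (\<exists>x. \<Phi> x \<noteq> 1)"

text \<open>
  The Haar measure \<open>dx\<close> giving the ring of integers measure \<open>1\<close>.  Regularity is not listed,
  since the field is second countable and locally compact.
\<close>

definition normalised_haar :: "('k::{field, metric_space} \<Rightarrow> int) \<Rightarrow> 'k measure \<Rightarrow> bool" where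
  "normalised_haar ord \<mu> \<longleftrightarrow>
     sets \<mu> = sets borel \<and>
     (\<forall>a. distr \<mu> borel ((+) a) = \<mu>) \<and>
     (\<forall>K. compact K \<longrightarrow> emeasure \<mu> K < \<infinity>) \<and>
     emeasure \<mu> (ring_of_integers ord) = 1"

definition mult_haar :: "('k::{field, metric_space} \<Rightarrow> int) \<Rightarrow> 'k measure \<Rightarrow> 'k measure" where
  "mult_haar ord \<mu> = density \<mu> (\<lambda>x. ennreal (inverse (abs_val ord x)))"

definition ord_shell :: "('k::field \<Rightarrow> int) \<Rightarrow> int \<Rightarrow> 'k set" where
  "ord_shell ord n = {x. x \<noteq> 0 \<and> ord x = n}"

text \<open>
  The pair \<open>(a, b)\<close> stands for the element \<open>a + b \<surd>\<theta>\<close> of the quadratic extension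
  \<open>k(\<surd>\<theta>)\<close>, where \<open>\<theta>\<close> is not a square.
\<close>

definition quad_norm :: "'k::field \<Rightarrow> 'k \<times> 'k \<Rightarrow> 'k" where
  "quad_norm \<theta> = (\<lambda>(a, b). a\<^sup>2 - b\<^sup>2 * \<theta>)"

definition norm_group :: "'k::field \<Rightarrow> 'k set" where
  "norm_group \<theta> = quad_norm \<theta> ` (UNIV - {(0, 0)})"


section \<open>Tori in \<open>SL\<^sub>2\<close>\<close>

definition SL2 :: "('k::field^2^2) set" where
  "SL2 = {g. det g = 1}"

definition sl2 :: "('k::field^2^2) set" where
  "sl2 = {Z. trace Z = 0}"

definition torus :: "'k::field \<Rightarrow> ('k^2^2) set" where
  "torus \<theta> = {vector [vector [a, b], vector [b * \<theta>, a]] | a b. a\<^sup>2 - b\<^sup>2 * \<theta> = 1}"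

definition G_conjugate :: "('k::field^2^2) set \<Rightarrow> ('k^2^2) set \<Rightarrow> bool" where
  "G_conjugate S T \<longleftrightarrow> (\<exists>g\<in>SL2. T = (\<lambda>t. g ** t ** matrix_inv g) ` S)"

definition root_mat :: "'k::field \<Rightarrow> 'k^2^2" where
  "root_mat \<theta> = vector [vector [0, 1], vector [\<theta>, 0]]"

definition torus_elt :: "'k::field \<Rightarrow> 'k \<Rightarrow> 'k^2^2" where
  "torus_elt c \<theta> = (\<chi> i j. c * root_mat \<theta> $ i $ j)"

definition torus_lie :: "'k::field \<Rightarrow> ('k^2^2) set" where
  "torus_lie \<theta> = {torus_elt c \<theta> | c. True}"

text \<open>
  The functional on \<open>sl\<^sub>2\<close> represented by the matrix \<open>X\<close>, so that the pairing of
  \<open>trace_dual X\<close> with \<open>Z\<close> is \<open>trace_dual X Z\<close>.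
\<close>

definition trace_dual :: "'k::field^2^2 \<Rightarrow> 'k^2^2 \<Rightarrow> 'k" where
  "trace_dual X = restrict (\<lambda>Z. trace (X ** Z)) sl2"

text \<open>
  For \<open>Z = c \<surd>\<theta>\<close> in \<open>torus_lie \<theta>\<close>, the coefficient \<open>c\<close> is the upper right entry of \<open>Z\<close>.
\<close>

definition lie_depth :: "('k::field \<Rightarrow> int) \<Rightarrow> 'k \<Rightarrow> 'k^2^2 \<Rightarrow> ereal" where
  "lie_depth ord \<theta> Z = ext_ord ord ((Z $ 1 $ 2)\<^sup>2 * \<theta>) / 2"

definition dual_depth ::
  "('k::field \<Rightarrow> int) \<Rightarrow> ('k \<Rightarrow> complex) \<Rightarrow> 'k \<Rightarrow> ('k^2^2 \<Rightarrow> 'k) \<Rightarrow> real" where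
  "dual_depth ord \<Phi> \<theta> X =
     (GREATEST \<rho>. \<forall>Z\<in>torus_lie \<theta>. lie_depth ord \<theta> Z > ereal (- \<rho>) \<longrightarrow> \<Phi> (X Z) = 1)"


section \<open>The mock Fourier transform\<close>

text \<open>
  The value at \<open>Y = s \<surd>\<theta>'\<close> of the transform attached to \<open>X\<^sup>* = \<beta> \<surd>\<omega>\<close>.
\<close>

definition mock_fourier ::
  "('k::{field, metric_space} \<Rightarrow> int) \<Rightarrow> 'k measure \<Rightarrow> ('k \<Rightarrow> complex) \<Rightarrow>
    'k \<Rightarrow> 'k \<Rightarrow> 'k \<Rightarrow> 'k \<Rightarrow> complex" where
  "mock_fourier ord \<mu> \<Phi> \<omega> \<beta> s \<theta>' =
     (\<Sum>\<^sub>\<infinity>n\<in>(UNIV :: int set).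
        LINT x : ord_shell ord n | mult_haar ord \<mu>.
          indicator (norm_group \<omega>) x *
          (\<Sum>\<^sub>\<infinity>l\<in>(UNIV :: int set).
             LINT t : ord_shell ord l | \<mu>.
               \<Phi> (\<beta> * s * (x * \<theta>' + inverse x * \<omega> - inverse x * t\<^sup>2))))"

end

theory Submission
  imports Defs
begin

text \<open>
  Rescale \<open>\<Phi>\<close> to \<open>\<psi> y = \<Phi> (\<beta> s y)\<close>, and let \<open>\<psi>\<close> be trivial on elements of valuation at least \<open>M\<close>
  but not on those of valuation \<open>M - 1\<close>; the depth hypothesis then says \<open>ord \<theta>' + 3 < 2 M\<close>.
  On \<open>ord x = n\<close> the inner integrals, the weight \<open>|x|\<^sup>-\<^sup>1\<close> and the indicator of the norm group are
  invariant under \<open>x \<mapsto> x + w\<close> with \<open>ord w > n\<close>, so only the phase \<open>x \<theta>' + \<omega> / x\<close> oscillates.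
  Its derivative \<open>\<theta>' - \<omega> / x\<^sup>2\<close> has the valuation \<open>min (ord \<theta>') (1 - 2 n)\<close> of its larger term
  unless both terms cancel to leading order, and then the depth hypothesis forces the integral
  over every shell to vanish.  If they do cancel at some norm \<open>x\<close>, Hensel's lemma makes the tori
  conjugate.
\<close>

section \<open>Fractional ideals, residues and Hensel\<close>

context nonarch_local_field
begin

text \<open>This is the power p^j of the maximal ideal. The implication admits 0, whatever value
  \<open>ord 0\<close> may have.\<close>

definition frac_ideal :: "int \<Rightarrow> 'k set" where
  "frac_ideal j = {x. x \<noteq> 0 \<longrightarrow> j \<le> ord x}"

lemma ord_1 [simp]: "ord 1 = 0"
  using ord_mult[of 1 1] by simp

lemma ord_minus [simp]: "ord (- x) = ord x"
proof (cases "x = 0")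
  case False
  have "ord (- 1) + ord (- 1) = ord 1"
    using ord_mult[of "- 1" "- 1"] by simp
  then have "ord (- 1) = 0" by simp
  then show ?thesis using ord_mult[of "- 1" x] False by simp
qed simp

lemma ord_inverse: "x \<noteq> 0 \<Longrightarrow> ord (inverse x) = - ord x"
  using ord_mult[of x "inverse x"] by simp

lemma ord_divide: "x \<noteq> 0 \<Longrightarrow> y \<noteq> 0 \<Longrightarrow> ord (x / y) = ord x - ord y"
  using ord_mult[of x "inverse y"] ord_inverse[of y] by (simp add: divide_inverse)

lemma ord_power2: "x \<noteq> 0 \<Longrightarrow> ord (x\<^sup>2) = 2 * ord x"
  by (simp add: power2_eq_square ord_mult)

lemma frac_ideal_0 [simp]: "0 \<in> frac_ideal j"
  by (simp add: frac_ideal_def)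

lemma frac_ideal_add: "x \<in> frac_ideal j \<Longrightarrow> y \<in> frac_ideal j \<Longrightarrow> x + y \<in> frac_ideal j"
  using ord_add[of x y] by (cases "x = 0"; cases "y = 0") (auto simp: frac_ideal_def)

lemma frac_ideal_minus_iff [simp]: "- x \<in> frac_ideal j \<longleftrightarrow> x \<in> frac_ideal j"
  by (simp add: frac_ideal_def)

lemma frac_ideal_diff: "x \<in> frac_ideal j \<Longrightarrow> y \<in> frac_ideal j \<Longrightarrow> x - y \<in> frac_ideal j"
  using frac_ideal_add[of x j "- y"] by simp

lemma frac_ideal_mono: "x \<in> frac_ideal i \<Longrightarrow> j \<le> i \<Longrightarrow> x \<in> frac_ideal j"
  by (auto simp: frac_ideal_def)

lemma frac_ideal_mult:
  "x \<in> frac_ideal i \<Longrightarrow> y \<in> frac_ideal j \<Longrightarrow> m \<le> i + j \<Longrightarrow> x * y \<in> frac_ideal m"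
  by (auto simp: frac_ideal_def ord_mult)

lemma frac_ideal_divide:
  "x \<in> frac_ideal i \<Longrightarrow> y \<noteq> 0 \<Longrightarrow> m \<le> i - ord y \<Longrightarrow> x / y \<in> frac_ideal m"
  by (auto simp: frac_ideal_def ord_divide)

lemma ord_in_frac_ideal: "j \<le> ord x \<Longrightarrow> x \<in> frac_ideal j"
  by (simp add: frac_ideal_def)

lemma ex_ord: "\<exists>x. x \<noteq> 0 \<and> ord x = j"
proof -
  have "j \<in> ord ` (UNIV - {0})" using ord_surj by simp
  then show ?thesis by auto
qed

text \<open>The strict case of the ultrametric inequality. Thus every shell is a union of cosets x +
  p^(ord x + 1), the scale on which all factors except the phase will be constant.\<close>

lemma ord_shell_add:
  assumes "x \<noteq> 0" "w \<in> frac_ideal (ord x + 1)"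
  shows "x + w \<noteq> 0" "ord (x + w) = ord x"
proof -
  have *: "w = 0 \<or> ord w > ord x" using assms(2) by (auto simp: frac_ideal_def)
  show 1: "x + w \<noteq> 0"
  proof
    assume "x + w = 0"
    then have "w = - x" by (simp add: eq_neg_iff_add_eq_0 add.commute)
    then show False using * assms(1) by auto
  qed
  show "ord (x + w) = ord x"
  proof (cases "w = 0")
    case False
    have "ord (x + w) \<ge> ord x" using ord_add[OF assms(1) False 1] * False by simp
    \<comment> \<open>The upper bound on \<open>ord (x + w)\<close> comes from writing x as (x + w)
      - w.\<close>
    moreover have "ord x \<ge> min (ord (x + w)) (ord w)"
      using ord_add[of "x + w" "- w"] 1 False assms(1) by simp
    ultimately show ?thesis using * False by linarith
  qed simp
qed

lemma ring_of_integers_eq: "ring_of_integers ord = frac_ideal 0"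
  by (auto simp: ring_of_integers_def frac_ideal_def ext_ord_def)

lemma max_ideal_eq: "max_ideal ord = frac_ideal 1"
  by (auto simp: max_ideal_def frac_ideal_def ext_ord_def)

section \<open>Residue classes and their representatives\<close>

definition congr_max :: "('k \<times> 'k) set" where
  "congr_max = {(x, y). x \<in> frac_ideal 0 \<and> y \<in> frac_ideal 0 \<and> x - y \<in> frac_ideal 1}"

lemma residue_field_eq: "residue_field ord = frac_ideal 0 // congr_max"
  by (simp add: residue_field_def congr_max_def ring_of_integers_eq max_ideal_eq)

lemma equiv_congr_max: "equiv (frac_ideal 0) congr_max"
proof (rule equivI)
  show "sym congr_max"
    by (rule symI) (auto simp: congr_max_def dest: frac_ideal_minus_iff[THEN iffD2])
  show "trans congr_max"
    by (rule transI) (auto simp: congr_max_def dest: frac_ideal_add[where j = 1])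
  show "refl_on (frac_ideal 0) congr_max"
    by (auto simp: refl_on_def congr_max_def)
  show "congr_max \<subseteq> frac_ideal 0 \<times> frac_ideal 0"
    by (auto simp: congr_max_def)
qed

text \<open>Chosen representatives let sums over the residue field be written as sums of values at
  field elements, without a ring structure on the quotient.\<close>

definition rep :: "'k set \<Rightarrow> 'k" where
  "rep C = (SOME c. c \<in> C)"

lemma rep_mem: "C \<in> residue_field ord \<Longrightarrow> rep C \<in> C"
  unfolding rep_def residue_field_eq
  by (metis equiv_congr_max in_quotient_imp_non_empty some_in_eq)

lemma rep_integral: "C \<in> residue_field ord \<Longrightarrow> rep C \<in> frac_ideal 0"
  using rep_mem in_quotient_imp_subset[OF equiv_congr_max] unfolding residue_field_eq by blast

lemma class_in_residue_field: "x \<in> frac_ideal 0 \<Longrightarrow> congr_max `` {x} \<in> residue_field ord"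
  by (simp add: residue_field_eq quotientI)

lemma rep_class: "x \<in> frac_ideal 0 \<Longrightarrow> rep (congr_max `` {x}) - x \<in> frac_ideal 1"
  using rep_mem[OF class_in_residue_field, of x] frac_ideal_minus_iff[of "rep (congr_max `` {x}) - x" 1]
  by (auto simp: congr_max_def)

lemma rep_inj:
  assumes "C \<in> residue_field ord" "D \<in> residue_field ord" "rep C - rep D \<in> frac_ideal 1"
  shows "C = D"
proof -
  have "(rep C, rep D) \<in> congr_max"
    using assms rep_integral by (simp add: congr_max_def)
  then show ?thesis
    using quotient_eqI[OF equiv_congr_max, of C D] assms rep_mem unfolding residue_field_eq by blast
qed

lemma residue_order_gt_1: "residue_order ord > 1"
proof -
  have "congr_max `` {0} \<noteq> congr_max `` {1}"
    using equiv_class_eq_iff[OF equiv_congr_max, of 0 1]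
    by (auto simp: congr_max_def frac_ideal_def)
  then have "card {congr_max `` {0}, congr_max `` {1}} = 2" by simp
  moreover have "{congr_max `` {0}, congr_max `` {1}} \<subseteq> residue_field ord"
    using class_in_residue_field by (auto simp: frac_ideal_def)
  then have "card {congr_max `` {0}, congr_max `` {1}} \<le> residue_order ord"
    unfolding residue_order_def by (rule card_mono[OF finite_residue_field])
  ultimately show ?thesis by linarith
qed

section \<open>Balls, the unit 2 and square roots near 1\<close>

lemma abs_val_mult: "abs_val ord (x * y) = abs_val ord x * abs_val ord y"
  using residue_order_gt_1
  by (auto simp: abs_val_def ord_mult power_int_add[symmetric] algebra_simps)

lemma abs_val_le_iff: "abs_val ord x \<le> real (residue_order ord) powi (- j) \<longleftrightarrow> x \<in> frac_ideal j"
proof (cases "x = 0")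
  case False
  have "real (residue_order ord) > 1" using residue_order_gt_1 by simp
  then show ?thesis
    using False power_int_increasing[of "- ord x" "- j" "real (residue_order ord)"]
      power_int_strict_increasing[of "- j" "- ord x" "real (residue_order ord)"]
    by (auto simp: abs_val_def frac_ideal_def not_le[symmetric])
qed (simp add: abs_val_def)

lemma abs_val_minus [simp]: "abs_val ord (- x) = abs_val ord x"
  by (simp add: abs_val_def)

text \<open>As closed balls the fractional ideals are closed, hence complete; Banach's fixed point
  theorem will be applied on one of them.\<close>

lemma frac_ideal_eq_cball: "frac_ideal j = cball 0 (real (residue_order ord) powi (- j))"
  by (auto simp: dist_abs_val abs_val_le_iff)

lemma two_unit:
  assumes "residue_char ord \<noteq> 2"
  shows "(2 :: 'k) \<noteq> 0" "ord 2 = 0"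
proof -
  let ?S = "{n. of_nat n \<in> max_ideal ord}"
  have "2 \<notin> frac_ideal 1"
  proof
    assume 2: "2 \<in> frac_ideal 1"
    \<comment> \<open>An odd n = 2 m + 1 in the maximal ideal would put 1 there too. So all such n
      are even, and as 2 is among them the gcd is 2.\<close>
    have "2 dvd n" if "of_nat n \<in> max_ideal ord" for n
    proof (rule ccontr)
      assume "\<not> 2 dvd n"
      then obtain m where "n = 2 * m + 1" by (elim oddE)
      then have n: "of_nat n = 2 * of_nat m + (1 :: 'k)" by simp
      have nat: "of_nat m \<in> frac_ideal 0"
        by (induction m) (auto intro!: frac_ideal_add simp: ord_in_frac_ideal)
      have "2 * of_nat m \<in> frac_ideal 1"
        using frac_ideal_mult[OF 2 nat] by simp
      from frac_ideal_diff[OF _ this] that n have "1 \<in> frac_ideal 1"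
        unfolding max_ideal_eq by (metis add_diff_cancel_left')
      then show False by (simp add: frac_ideal_def)
    qed
    then have "2 dvd Gcd ?S" by (intro Gcd_greatest) auto
    moreover have "Gcd ?S dvd 2" by (rule Gcd_dvd) (simp add: max_ideal_eq 2)
    ultimately have "Gcd ?S = 2" by (rule dvd_antisym[rotated])
    then show False using assms by (simp add: residue_char_def)
  qed
  moreover have "2 \<in> frac_ideal 0"
    using frac_ideal_add[of 1 0 1] by (simp add: ord_in_frac_ideal)
  ultimately show "(2 :: 'k) \<noteq> 0" "ord 2 = 0"
    by (auto simp: frac_ideal_def)
qed

text \<open>Hensel's lemma for squares: with c = 1 + z the equation c^2 = 1 + y becomes z = (y -
  z^2) / 2. Since 2 is a unit, the right side maps the maximal ideal to itself and contracts it by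
  the factor 1 / q.\<close>

lemma square_root_near_1:
  assumes "residue_char ord \<noteq> 2" and y: "y \<in> frac_ideal 1"
  obtains c where "c - 1 \<in> frac_ideal 1" "c\<^sup>2 = 1 + y"
proof -
  note two = two_unit[OF assms(1)]
  define q where "q = real (residue_order ord)"
  have q: "q > 1" using residue_order_gt_1 by (simp add: q_def)
  have "closed (frac_ideal 1)" by (simp add: frac_ideal_eq_cball)
  then have "complete (frac_ideal 1)"
    using complete_closed_subset[OF _ subset_UNIV complete_UNIV] by blast
  define f where "f z = (y - z\<^sup>2) / 2" for z
  have "\<exists>!z. z \<in> frac_ideal 1 \<and> f z = z"
  proof (rule Banach_fix[where c = "1 / q"])
    show "f ` frac_ideal 1 \<subseteq> frac_ideal 1"
    proof safe
      fix z assume z: "z \<in> frac_ideal 1"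
      show "f z \<in> frac_ideal 1"
        unfolding f_def power2_eq_square
        by (rule frac_ideal_divide[OF frac_ideal_diff[OF y frac_ideal_mult[OF z z]]]) (auto simp: two)
    qed
    show "dist (f z) (f z') \<le> 1 / q * dist z z'" if "z \<in> frac_ideal 1" "z' \<in> frac_ideal 1" for z z'
    proof -
      \<comment> \<open>The factor (z + z') / 2 lies in the maximal ideal, which gives the
        contraction constant.\<close>
      have "f z - f z' = - ((z + z') / 2) * (z - z')"
      proof -
        have "f z - f z' = ((y - z\<^sup>2) - (y - z'\<^sup>2)) / 2"
          by (simp only: f_def diff_divide_distrib)
        also have "(y - z\<^sup>2) - (y - z'\<^sup>2) = - (z + z') * (z - z')"
          by (simp add: power2_eq_square algebra_simps)
        finally show ?thesis by (simp only: minus_divide_left times_divide_eq_left)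
      qed
      moreover have "(z + z') / 2 \<in> frac_ideal 1"
        using that by (intro frac_ideal_divide[OF frac_ideal_add]) (auto simp: two)
      then have "abs_val ord ((z + z') / 2) \<le> 1 / q"
        using abs_val_le_iff[of "(z + z') / 2" 1] q by (simp add: q_def power_int_minus inverse_eq_divide)
      moreover have "abs_val ord (z - z') \<ge> 0" by (metis dist_abs_val zero_le_dist)
      ultimately show ?thesis
        unfolding dist_abs_val
        by (metis abs_val_minus abs_val_mult mult_right_mono)
    qed
    show "frac_ideal 1 \<noteq> {}" using frac_ideal_0 by blast
  qed (use q \<open>complete (frac_ideal 1)\<close> in auto)
  then obtain z where z: "z \<in> frac_ideal 1" "f z = z" by blast
  show thesis
  proof
    show "1 + z - 1 \<in> frac_ideal 1" using z by simp
    have "y - z\<^sup>2 = 2 * z" using z(2) two(1) by (simp add: f_def field_simps)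
    then show "(1 + z)\<^sup>2 = 1 + y" by (simp add: power2_eq_square algebra_simps)
  qed
qed

end

section \<open>Additive characters and oscillating integrals\<close>

text \<open>The circle has no small subgroups. While u stays within 1/2 of 1, |u + 1| is at least
  3/2, so each squaring multiplies the distance to 1 by at least 3/2; this cannot go on forever
  unless the distance is 0.\<close>

lemma small_powers_eq_1:
  fixes z :: complex
  assumes small: "\<And>n. norm (z ^ n - 1) < 1 / 2"
  shows "z = 1"
proof (rule ccontr)
  assume "z \<noteq> 1"
  have growth: "(3 / 2) ^ n * norm (z - 1) \<le> norm (z ^ (2 ^ n) - 1)" for n
  proof (induction n)
    case (Suc n)
    define u where "u = z ^ (2 ^ n)"
    have "norm (u + 1) \<ge> 3 / 2"
      using norm_triangle_ineq4[of "u + 1" "u - 1"] small[of "2 ^ n"] by (simp add: u_def)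
    then have "(3 / 2) * norm (u - 1) \<le> norm (u + 1) * norm (u - 1)"
      by (rule mult_right_mono) simp
    also have "\<dots> = norm (u\<^sup>2 - 1)"
      by (simp add: norm_mult[symmetric] power2_eq_square algebra_simps)
    also have "u\<^sup>2 = z ^ (2 ^ Suc n)" by (simp add: u_def power_mult[symmetric] mult.commute)
    finally show ?case using Suc.IH by (simp add: u_def)
  qed simp
  obtain n where "1 / norm (z - 1) < (3 / 2) ^ n"
    using real_arch_pow[of "3 / 2" "1 / norm (z - 1)"] by auto
  then have "1 < (3 / 2) ^ n * norm (z - 1)"
    using \<open>z \<noteq> 1\<close> by (simp add: field_simps)
  with growth[of n] small[of "2 ^ n"] show False by linarith
qed

context nonarch_local_field
begin

text \<open>M is the conductor exponent of \<open>\<psi>\<close>: p^M is the largest fractional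
  ideal in its kernel.\<close>

definition char_level :: "('k \<Rightarrow> complex) \<Rightarrow> int \<Rightarrow> bool" where
  "char_level \<psi> M \<longleftrightarrow> (\<forall>x y. \<psi> (x + y) = \<psi> x * \<psi> y) \<and>
     (\<forall>x\<in>frac_ideal M. \<psi> x = 1) \<and> (\<exists>x\<in>frac_ideal (M - 1). \<psi> x \<noteq> 1)"

lemma char_level_add: "char_level \<psi> M \<Longrightarrow> \<psi> (x + y) = \<psi> x * \<psi> y"
  by (simp add: char_level_def)

lemma char_level_trivial: "char_level \<psi> M \<Longrightarrow> x \<in> frac_ideal M \<Longrightarrow> \<psi> x = 1"
  by (simp add: char_level_def)

lemma char_level_nonzero:
  assumes "char_level \<psi> M"
  shows "\<psi> x \<noteq> 0"
proof
  assume "\<psi> x = 0"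
  then have "\<psi> (x + - x) = 0" by (simp only: char_level_add[OF assms] mult_zero_left)
  then show False using char_level_trivial[OF assms frac_ideal_0] by simp
qed

lemma char_level_cong:
  assumes "char_level \<psi> M" "x - y \<in> frac_ideal M"
  shows "\<psi> x = \<psi> y"
  using char_level_add[OF assms(1), of y "x - y"] char_level_trivial[OF assms] by simp

lemma char_level_scale:
  assumes "char_level \<psi> M" "a \<noteq> 0"
  shows "char_level (\<lambda>y. \<psi> (a * y)) (M - ord a)"
proof -
  obtain x where x: "x \<in> frac_ideal (M - 1)" "\<psi> x \<noteq> 1"
    using assms(1) by (auto simp: char_level_def)
  have "\<psi> (a * y) = 1" if "y \<in> frac_ideal (M - ord a)" for y
    using frac_ideal_mult[OF ord_in_frac_ideal[OF order.refl, of a] that, of M]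
      char_level_trivial[OF assms(1)] by simp
  moreover have "x / a \<in> frac_ideal (M - ord a - 1)" "\<psi> (a * (x / a)) \<noteq> 1"
    using x frac_ideal_divide[OF x(1) assms(2)] assms(2) by auto
  ultimately show ?thesis
    using char_level_add[OF assms(1)] unfolding char_level_def distrib_left by blast
qed

text \<open>By continuity \<open>\<Phi>\<close> is close to 1 on some p^n. As p^n is closed under
  addition, all powers of \<open>\<Phi> x\<close> stay close to 1 for x in p^n, and
  \<open>small_powers_eq_1\<close> applies.\<close>

lemma add_char_trivial_near_0:
  assumes "add_char \<Phi>"
  obtains m where "\<And>x. x \<in> frac_ideal m \<Longrightarrow> \<Phi> x = 1"
proof -
  have add: "\<Phi> (x + y) = \<Phi> x * \<Phi> y" for x y using assms by (simp add: add_char_def)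
  have "norm (\<Phi> 0) = 1" using assms by (simp add: add_char_def)
  then have "\<Phi> 0 = 1" using add[of 0 0] by fastforce
  have "\<forall>e>0. \<exists>d>0. \<forall>x. dist x 0 < d \<longrightarrow> dist (\<Phi> x) (\<Phi> 0) < e"
    using assms by (simp add: add_char_def continuous_on_iff)
  from this[rule_format, of "1 / 2"] obtain d where d: "d > 0" "\<And>x. abs_val ord x < d \<Longrightarrow> norm (\<Phi> x - 1) < 1 / 2"
    using \<open>\<Phi> 0 = 1\<close> by (auto simp: dist_abs_val dist_norm)
  let ?q = "real (residue_order ord)"
  have q: "?q > 1" using residue_order_gt_1 by simp
  obtain n where n: "1 / d < ?q ^ n" using real_arch_pow[OF q] by blast
  have small: "?q powi (- int n) < d"
    using n d(1) q by (simp add: power_int_minus field_simps)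
  have "\<Phi> x = 1" if x: "x \<in> frac_ideal (int n)" for x
  proof (rule small_powers_eq_1)
    fix j
    have "\<Phi> (of_nat j * x) = \<Phi> x ^ j"
      by (induction j) (simp_all add: \<open>\<Phi> 0 = 1\<close> add distrib_right)
    moreover have "of_nat j * x \<in> frac_ideal (int n)"
      by (induction j) (auto simp: distrib_right intro: frac_ideal_add x)
    then have "abs_val ord (of_nat j * x) < d"
      using small abs_val_le_iff[of "of_nat j * x" "int n"] by linarith
    ultimately show "norm (\<Phi> x ^ j - 1) < 1 / 2"
      using d(2) by metis
  qed
  then show thesis using that by blast
qed

lemma char_level_exists:
  assumes "nontrivial_add_char \<Phi>"
  obtains M where "char_level \<Phi> M"
proof -
  have add: "\<Phi> (x + y) = \<Phi> x * \<Phi> y" for x y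
    using assms by (simp add: nontrivial_add_char_def add_char_def)
  obtain m where m: "\<And>x. x \<in> frac_ideal m \<Longrightarrow> \<Phi> x = 1"
    using assms add_char_trivial_near_0 unfolding nontrivial_add_char_def by blast
  obtain x where x: "\<Phi> x \<noteq> 1"
    using assms by (auto simp: nontrivial_add_char_def)
  let ?T = "\<lambda>n. \<forall>y\<in>frac_ideal (ord x + 1 + int n). \<Phi> y = 1"
  have "?T (nat (m - ord x))"
    using m frac_ideal_mono[where j = m] by auto
  then have ex: "\<exists>n. ?T n" by blast
  define n where "n = (LEAST n. ?T n)"
  have Tn: "?T n" unfolding n_def by (rule LeastI_ex[OF ex])
  have "\<exists>y\<in>frac_ideal (ord x + 1 + int n - 1). \<Phi> y \<noteq> 1"
  \<comment> \<open>If the search stops at once, the witness one level down is x itself; otherwise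
    minimality of n supplies it.\<close>
  proof (cases n)
    case 0
    then show ?thesis using x by (auto simp: frac_ideal_def)
  next
    case (Suc n')
    then have "\<not> ?T n'" using not_less_Least[of n' ?T] by (simp add: n_def)
    then show ?thesis using Suc by (simp add: algebra_simps)
  qed
  with Tn have "char_level \<Phi> (ord x + 1 + int n)"
    unfolding char_level_def using add by blast
  then show thesis by (rule that)
qed

section \<open>Orthogonality on the residue field and vanishing integrals\<close>

lemma sum_residues_char_eq_0:
  assumes \<psi>: "char_level \<psi> M" and g: "g \<noteq> 0" "ord g = M - 1"
  shows "(\<Sum>C\<in>residue_field ord. \<psi> (g * rep C)) = 0"
proof -
  obtain a where a: "a \<in> frac_ideal (M - 1)" "\<psi> a \<noteq> 1"
    using \<psi> by (auto simp: char_level_def)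
  \<comment> \<open>Since g b = a, translation by b permutes the residue classes and multiplies the
    sum by \<open>\<psi> a\<close>, which is not 1. Hence the sum is 0.\<close>
  define b where "b = a / g"
  have b: "b \<in> frac_ideal 0" unfolding b_def
    by (rule frac_ideal_divide[OF a(1) g(1)]) (simp add: g)
  define \<tau> where "\<tau> C = congr_max `` {rep C + b}" for C
  have int: "rep C + b \<in> frac_ideal 0" if "C \<in> residue_field ord" for C
    using that rep_integral b by (intro frac_ideal_add)
  have \<tau>_in: "\<tau> ` residue_field ord \<subseteq> residue_field ord"
    unfolding \<tau>_def using int class_in_residue_field by blast
  have rep_\<tau>: "rep (\<tau> C) - (rep C + b) \<in> frac_ideal 1" if "C \<in> residue_field ord" for C
    unfolding \<tau>_def by (rule rep_class[OF int[OF that]])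
  have "inj_on \<tau> (residue_field ord)"
  proof (rule inj_onI)
    fix C D assume C: "C \<in> residue_field ord" and D: "D \<in> residue_field ord" and "\<tau> C = \<tau> D"
    then have "rep C - rep D \<in> frac_ideal 1"
      using frac_ideal_diff[OF rep_\<tau>[OF D] rep_\<tau>[OF C]] by simp
    then show "C = D" by (rule rep_inj[OF C D])
  qed
  then have bij: "bij_betw \<tau> (residue_field ord) (residue_field ord)"
    using endo_inj_surj[OF finite_residue_field \<tau>_in] by (auto simp: bij_betw_def)
  have shift: "\<psi> (g * rep (\<tau> C)) = \<psi> a * \<psi> (g * rep C)" if "C \<in> residue_field ord" for C
  proof -
    have "g * (rep (\<tau> C) - (rep C + b)) \<in> frac_ideal M"
      using frac_ideal_mult[OF ord_in_frac_ideal[OF order.refl] rep_\<tau>[OF that]] g by simp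
    moreover have "g * (rep (\<tau> C) - (rep C + b)) = g * rep (\<tau> C) - (a + g * rep C)"
      using g by (simp add: b_def field_simps)
    ultimately have "\<psi> (g * rep (\<tau> C)) = \<psi> (a + g * rep C)"
      using char_level_cong[OF \<psi>] by metis
    then show ?thesis by (simp add: char_level_add[OF \<psi>])
  qed
  let ?S = "\<Sum>C\<in>residue_field ord. \<psi> (g * rep C)"
  have "?S = (\<Sum>C\<in>residue_field ord. \<psi> (g * rep (\<tau> C)))"
    by (rule sum.reindex_bij_betw[OF bij, symmetric])
  also have "\<dots> = \<psi> a * ?S"
    by (simp add: shift sum_distrib_left)
  finally show ?thesis using a(2) by simp
qed

lemma integral_translate:
  fixes F :: "'k \<Rightarrow> complex"
  assumes \<mu>: "normalised_haar ord \<mu>" and F: "integrable \<mu> F"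
  shows "integrable \<mu> (\<lambda>x. F (x + a))" "integral\<^sup>L \<mu> (\<lambda>x. F (x + a)) = integral\<^sup>L \<mu> F"
proof -
  have sets: "sets \<mu> = sets borel" and distr: "distr \<mu> borel ((+) a) = \<mu>"
    using \<mu> by (auto simp: normalised_haar_def)
  \<comment> \<open>Translations are isometries, because the distance depends only on the
    difference.\<close>
  have "continuous_on UNIV ((+) a)"
    unfolding continuous_on_iff by (metis add_diff_cancel_left dist_abs_val)
  then have "(+) a \<in> borel_measurable borel" by (rule borel_measurable_continuous_onI)
  then have m: "(+) a \<in> measurable \<mu> borel"
    using measurable_cong_sets[OF sets refl] by blast
  have Fm: "F \<in> borel_measurable borel"
    using borel_measurable_integrable[OF F] measurable_cong_sets[OF sets refl] by blast
  show "integrable \<mu> (\<lambda>x. F (x + a))"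
    using integrable_distr_eq[OF m Fm] F unfolding distr by (simp add: add.commute)
  show "integral\<^sup>L \<mu> (\<lambda>x. F (x + a)) = integral\<^sup>L \<mu> F"
    using integral_distr[OF m Fm] unfolding distr by (simp add: add.commute)
qed

text \<open>The integral is the mean of the integrals of q translates by representatives of p^r /
  p^(r+1). Near each point of the support F varies by w -> \<open>\<psi> (g * w)\<close>, which is
  trivial on p^(r+1) but not on p^r, so the translates sum to 0 pointwise; g may depend on the
  point. A non-integrable F has integral 0 by convention.\<close>

lemma oscillating_integral_eq_0:
  fixes F :: "'k \<Rightarrow> complex"
  assumes \<mu>: "normalised_haar ord \<mu>" and \<psi>: "char_level \<psi> M"
    and osc: "\<And>x. F x \<noteq> 0 \<Longrightarrow>
      \<exists>g. g \<noteq> 0 \<and> ord g = M - 1 - r \<and> (\<forall>w\<in>frac_ideal r. F (x + w) = F x * \<psi> (g * w))"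
  shows "integral\<^sup>L \<mu> F = 0"
proof (cases "integrable \<mu> F")
  case True
  obtain w where w: "w \<noteq> 0" "ord w = r" using ex_ord by blast
  have w_rep: "w * rep C \<in> frac_ideal r" if "C \<in> residue_field ord" for C
    using frac_ideal_mult[OF ord_in_frac_ideal[OF order.refl, of w] rep_integral[OF that], of r] w
    by simp
  have avg: "(\<Sum>C\<in>residue_field ord. F (x + w * rep C)) = 0" for x
  proof (cases "F x = 0")
    case True
    \<comment> \<open>Zeros fill whole cosets of p^r: from a non-zero value at x + v, stepping back
      by v would give a non-zero value at x.\<close>
    have "F (x + v) = 0" if v: "v \<in> frac_ideal r" for v
    proof (rule ccontr)
      assume nz: "F (x + v) \<noteq> 0"
      then obtain g where "\<forall>u\<in>frac_ideal r. F (x + v + u) = F (x + v) * \<psi> (g * u)"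
        using osc by blast
      then have "F (x + v + - v) = F (x + v) * \<psi> (g * - v)" using v by (metis frac_ideal_minus_iff)
      then show False using True nz char_level_nonzero[OF \<psi>] by simp
    qed
    then show ?thesis using w_rep by simp
  next
    case False
    then obtain g where g: "g \<noteq> 0" "ord g = M - 1 - r"
      and F: "\<And>u. u \<in> frac_ideal r \<Longrightarrow> F (x + u) = F x * \<psi> (g * u)"
      using osc by blast
    have "(\<Sum>C\<in>residue_field ord. F (x + w * rep C))
        = F x * (\<Sum>C\<in>residue_field ord. \<psi> ((g * w) * rep C))"
      by (simp add: F w_rep sum_distrib_left mult.assoc)
    also have "\<dots> = 0"
      using sum_residues_char_eq_0[OF \<psi>, of "g * w"] g w by (simp add: ord_mult)
    finally show ?thesis .
  qed
  have "of_nat (residue_order ord) * integral\<^sup>L \<mu> F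
      = (\<Sum>C\<in>residue_field ord. integral\<^sup>L \<mu> (\<lambda>x. F (x + w * rep C)))"
    by (simp add: integral_translate[OF \<mu> True] residue_order_def)
  also have "\<dots> = integral\<^sup>L \<mu> (\<lambda>x. \<Sum>C\<in>residue_field ord. F (x + w * rep C))"
    by (intro Bochner_Integration.integral_sum[symmetric] integral_translate[OF \<mu> True])
  also have "\<dots> = 0" by (simp add: avg)
  finally show ?thesis using residue_order_gt_1 by simp
qed (rule not_integrable_integral_eq)

end

section \<open>The shells of the mock Fourier transform\<close>

text \<open>Integrability for the density already yields the measurability that the change of
  measure requires; in the other case the integral is 0 by convention.\<close>

lemma integral_density_eq_0:
  fixes F :: "'a \<Rightarrow> complex" and \<rho> :: "'a \<Rightarrow> real"
  assumes "\<rho> \<in> borel_measurable M" "\<And>x. 0 \<le> \<rho> x" "integral\<^sup>L M (\<lambda>x. \<rho> x *\<^sub>R F x) = 0"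
  shows "integral\<^sup>L (density M \<rho>) F = 0"
proof (cases "integrable (density M \<rho>) F")
  case True
  then have "F \<in> borel_measurable M" using borel_measurable_integrable by fastforce
  then show ?thesis using integral_density[of F M \<rho>] assms by simp
qed (rule not_integrable_integral_eq)

context nonarch_local_field
begin

text \<open>One shell of the quadratic Gauss integral that remains of the inner integral once the
  phase x \<open>\<theta>\<close> + \<open>\<omega>\<close> / x is factored out.\<close>

definition gauss_shell :: "'k measure \<Rightarrow> ('k \<Rightarrow> complex) \<Rightarrow> int \<Rightarrow> 'k \<Rightarrow> complex" where
  "gauss_shell \<mu> \<psi> l x = (LINT t : ord_shell ord l | \<mu>. \<psi> (- (t\<^sup>2 / x)))"

lemma gauss_shell_eq_0:
  assumes res: "residue_char ord \<noteq> 2" and \<mu>: "normalised_haar ord \<mu>" and \<psi>: "char_level \<psi> M"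
    and x: "x \<noteq> 0" and l: "2 * l \<le> M - 2 + ord x"
  shows "gauss_shell \<mu> \<psi> l x = 0"
  unfolding gauss_shell_def set_lebesgue_integral_def
proof (rule oscillating_integral_eq_0[OF \<mu> \<psi>])
  note two = two_unit[OF res]
  \<comment> \<open>The derivative -2 t / x has valuation l - ord x, which must equal M - 1 - r. The
    bound on l is exactly what gives both r > l, so that the shell is preserved, and 2 r - ord x >=
    M, so that \<open>\<psi>\<close> kills the quadratic term.\<close>
  define r where "r = M - 1 + ord x - l"
  fix t assume "indicator (ord_shell ord l) t *\<^sub>R \<psi> (- (t\<^sup>2 / x)) \<noteq> 0"
  then have t: "t \<noteq> 0" "ord t = l" by (auto simp: indicator_def ord_shell_def split: if_splits)
  define g where "g = - (2 * t / x)"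
  have "g \<noteq> 0" "ord g = M - 1 - r"
    using t x two by (simp_all add: g_def r_def ord_divide ord_mult)
  moreover have "indicator (ord_shell ord l) (t + w) *\<^sub>R \<psi> (- ((t + w)\<^sup>2 / x))
      = indicator (ord_shell ord l) t *\<^sub>R \<psi> (- (t\<^sup>2 / x)) * \<psi> (g * w)"
    if w: "w \<in> frac_ideal r" for w
  proof -
    have "w \<in> frac_ideal (ord t + 1)"
      using w l t by (elim frac_ideal_mono) (simp add: r_def)
    then have "t + w \<in> ord_shell ord l" using ord_shell_add[OF t(1)] t by (simp add: ord_shell_def)
    moreover have expand: "- ((t + w)\<^sup>2 / x) = - (t\<^sup>2 / x) + (g * w + - (w\<^sup>2 / x))"
      using x by (simp add: g_def field_simps power2_eq_square)
    have "\<psi> (- ((t + w)\<^sup>2 / x)) = \<psi> (- (t\<^sup>2 / x)) * (\<psi> (g * w) * \<psi> (- (w\<^sup>2 / x)))"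
      unfolding expand char_level_add[OF \<psi>] ..
    moreover have "- (w\<^sup>2 / x) \<in> frac_ideal M"
      unfolding power2_eq_square frac_ideal_minus_iff
      by (rule frac_ideal_divide[OF frac_ideal_mult[OF w w order.refl] x]) (use l in \<open>simp add: r_def\<close>)
    ultimately show ?thesis
      using t by (simp add: ord_shell_def char_level_trivial[OF \<psi>])
  qed
  ultimately show "\<exists>g. g \<noteq> 0 \<and> ord g = M - 1 - r \<and> (\<forall>w\<in>frac_ideal r.
      indicator (ord_shell ord l) (t + w) *\<^sub>R \<psi> (- ((t + w)\<^sup>2 / x))
      = indicator (ord_shell ord l) t *\<^sub>R \<psi> (- (t\<^sup>2 / x)) * \<psi> (g * w))"
    by blast
qed

text \<open>For small l both sides vanish by \<open>gauss_shell_eq_0\<close>. For all other l the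
  arguments of \<open>\<psi>\<close> differ by an element of p^M, since 2 l - ord x + 1 >= M; the
  two ranges of l meet without a gap.\<close>

lemma gauss_shell_shift:
  assumes res: "residue_char ord \<noteq> 2" and \<mu>: "normalised_haar ord \<mu>" and \<psi>: "char_level \<psi> M"
    and x: "x \<noteq> 0" and w: "w \<in> frac_ideal (ord x + 1)"
  shows "gauss_shell \<mu> \<psi> l (x + w) = gauss_shell \<mu> \<psi> l x"
proof (cases "2 * l \<le> M - 2 + ord x")
  case True
  then show ?thesis
    using gauss_shell_eq_0[OF res \<mu> \<psi>] x ord_shell_add[OF x w] by simp
next
  case False
  note xw = ord_shell_add[OF x w]
  have "\<psi> (- (t\<^sup>2 / (x + w))) = \<psi> (- (t\<^sup>2 / x))" if t: "t \<in> ord_shell ord l" for t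
  proof (rule char_level_cong[OF \<psi>])
    have "- (t\<^sup>2 / (x + w)) - - (t\<^sup>2 / x) = t\<^sup>2 * w / (x * (x + w))"
      using x xw by (simp add: field_simps)
    also have "\<dots> \<in> frac_ideal M"
    proof (rule frac_ideal_divide[OF frac_ideal_mult[OF ord_in_frac_ideal[OF order.refl] w order.refl]])
      show "M \<le> ord (t\<^sup>2) + (ord x + 1) - ord (x * (x + w))"
        using False t x xw by (simp add: ord_power2 ord_mult ord_shell_def)
    qed (use x xw in simp)
    finally show "- (t\<^sup>2 / (x + w)) - - (t\<^sup>2 / x) \<in> frac_ideal M" .
  qed
  then show ?thesis
    unfolding gauss_shell_def set_lebesgue_integral_def
    by (intro Bochner_Integration.integral_cong) (auto simp: indicator_def)
qed

text \<open>
  Here \<open>\<theta> - \<omega> / x\<^sup>2\<close> is the derivative of the phase \<open>x \<theta> + \<omega> / x\<close>, so the integral has no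
  stationary point on the support of \<open>h\<close>.
\<close>

lemma nonstationary_shell_integral_eq_0:
  assumes \<mu>: "normalised_haar ord \<mu>" and \<psi>: "char_level \<psi> M"
    and h: "\<And>x w. x \<noteq> 0 \<Longrightarrow> w \<in> frac_ideal (ord x + 1) \<Longrightarrow> h (x + w) = h x"
    and \<omega>: "\<omega> \<noteq> 0" and A: "A \<le> M - 2" "A \<le> ord \<omega> - n"
    and deriv: "\<And>x. x \<noteq> 0 \<Longrightarrow> ord x = n \<Longrightarrow> h x \<noteq> 0 \<Longrightarrow>
      \<theta> - \<omega> / x\<^sup>2 \<noteq> 0 \<and> ord (\<theta> - \<omega> / x\<^sup>2) = A - n"
  shows "integral\<^sup>L \<mu> (\<lambda>x. indicator (ord_shell ord n) x *\<^sub>R (h x * \<psi> (x * \<theta> + inverse x * \<omega>))) = 0"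
proof (rule oscillating_integral_eq_0[OF \<mu> \<psi>])
  \<comment> \<open>Chosen so that the derivative, of valuation A - n, has valuation M - 1 - r; A <=
    M - 2 then makes r > n.\<close>
  define r where "r = M - 1 - A + n"
  define F where "F x = indicator (ord_shell ord n) x *\<^sub>R (h x * \<psi> (x * \<theta> + inverse x * \<omega>))" for x
  fix x assume "indicator (ord_shell ord n) x *\<^sub>R (h x * \<psi> (x * \<theta> + inverse x * \<omega>)) \<noteq> 0"
  then have x: "x \<noteq> 0" "ord x = n" "h x \<noteq> 0"
    by (auto simp: indicator_def ord_shell_def split: if_splits)
  define g where "g = \<theta> - \<omega> / x\<^sup>2"
  have "g \<noteq> 0" "ord g = M - 1 - r"
    using deriv[OF x] by (simp_all add: g_def r_def)
  moreover have "F (x + w) = F x * \<psi> (g * w)" if w: "w \<in> frac_ideal r" for w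
  proof -
    have w': "w \<in> frac_ideal (ord x + 1)"
      using w A x by (elim frac_ideal_mono) (simp add: r_def)
    note xw = ord_shell_add[OF x(1) w']
    \<comment> \<open>Taylor expansion with exact remainder. Its valuation is at least (ord
      \<open>\<omega>\<close> - n - A) + (2 M - 2 - A), which is at least M by the two bounds on
      A.\<close>
    have "(x + w) * \<theta> + inverse (x + w) * \<omega>
        = (x * \<theta> + inverse x * \<omega>) + (g * w + \<omega> * (w * w) / (x\<^sup>2 * (x + w)))"
      using x xw by (simp add: g_def divide_simps) (simp add: algebra_simps power2_eq_square)
    moreover have "\<omega> * (w * w) / (x\<^sup>2 * (x + w)) \<in> frac_ideal M"
    proof (rule frac_ideal_divide[OF frac_ideal_mult[OF ord_in_frac_ideal[OF order.refl]
            frac_ideal_mult[OF w w order.refl] order.refl]])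
      show "M \<le> ord \<omega> + (r + r) - ord (x\<^sup>2 * (x + w))"
        using A x xw by (simp add: ord_power2 ord_mult r_def)
    qed (use x xw in simp)
    ultimately show ?thesis
      using x xw h[OF x(1) w']
      by (simp add: F_def ord_shell_def char_level_add[OF \<psi>] char_level_trivial[OF \<psi>])
  qed
  ultimately show "\<exists>g. g \<noteq> 0 \<and> ord g = M - 1 - r \<and> (\<forall>w\<in>frac_ideal r.
      indicator (ord_shell ord n) (x + w) *\<^sub>R
        (h (x + w) * \<psi> ((x + w) * \<theta> + inverse (x + w) * \<omega>))
      = indicator (ord_shell ord n) x *\<^sub>R (h x * \<psi> (x * \<theta> + inverse x * \<omega>)) * \<psi> (g * w))"
    unfolding F_def by blast
qed

section \<open>Norms and conjugate tori\<close>

lemma norm_group_shift: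
  assumes res: "residue_char ord \<noteq> 2" and x: "x \<noteq> 0" and w: "w \<in> frac_ideal (ord x + 1)"
    and N: "x \<in> norm_group \<omega>"
  shows "x + w \<in> norm_group \<omega>"
proof -
  have "w / x \<in> frac_ideal 1" by (rule frac_ideal_divide[OF w x]) simp
  then obtain c where c: "c - 1 \<in> frac_ideal 1" "c\<^sup>2 = 1 + w / x"
    using square_root_near_1[OF res] by blast
  have "c \<noteq> 0" using c(1) ord_shell_add(1)[of 1 "c - 1"] by simp
  obtain a b where ab: "(a, b) \<noteq> (0, 0)" "x = a\<^sup>2 - b\<^sup>2 * \<omega>"
    using N by (auto simp: norm_group_def quad_norm_def)
  \<comment> \<open>A norm times the square of an element of the base field is again a norm.\<close>
  have "x + w = c\<^sup>2 * x" using c(2) x by (simp add: field_simps)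
  also have "\<dots> = quad_norm \<omega> (c * a, c * b)"
    by (simp add: ab(2) quad_norm_def power_mult_distrib algebra_simps)
  finally show ?thesis
    using ab(1) \<open>c \<noteq> 0\<close> unfolding norm_group_def by auto
qed

lemma norm_group_shift_iff:
  assumes res: "residue_char ord \<noteq> 2" and x: "x \<noteq> 0" and w: "w \<in> frac_ideal (ord x + 1)"
  shows "x + w \<in> norm_group \<omega> \<longleftrightarrow> x \<in> norm_group \<omega>"
  using norm_group_shift[OF res x w] norm_group_shift[OF res, of "x + w" "- w"]
    ord_shell_add[OF x w] w by auto

end

text \<open>Let a + b sqrt(\<open>\<omega>\<close>) have norm 1 / d. Its multiplication matrix
  commutes with \<open>torus \<omega>\<close>, while diag(1, d) conjugates
  \<open>torus \<omega>\<close> to the torus of \<open>\<omega>\<close> d^2. The product g of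
  diag(1, d) with that matrix does the same and has determinant d / d = 1.\<close>

lemma G_conjugate_torus:
  fixes \<omega> d :: "'k::field"
  assumes d: "d \<noteq> 0" "inverse d \<in> norm_group \<omega>"
  shows "G_conjugate (torus \<omega>) (torus (\<omega> * d\<^sup>2))"
proof -
  obtain a b where ab: "inverse d = a\<^sup>2 - b\<^sup>2 * \<omega>"
    using d(2) by (auto simp: norm_group_def quad_norm_def)
  then have one: "d * a * a - d * b * b * \<omega> = 1"
    using d(1) by (metis (no_types, lifting) mult.assoc power2_eq_square right_diff_distrib right_inverse)
  define g :: "'k^2^2" where "g = vector [vector [a, b], vector [d * b * \<omega>, d * a]]"
  define g' :: "'k^2^2" where "g' = vector [vector [d * a, - b], vector [- (d * b * \<omega>), a]]"
  have inv: "g ** g' = mat 1 \<and> g' ** g = mat 1"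
    using one by (simp add: g_def g'_def matrix_matrix_mult_def mat_def vec_eq_iff forall_2 sum_2 algebra_simps)
  \<comment> \<open>\<open>matrix_inv\<close> is a choice among two-sided inverses; the explicit g'
    shows that one exists, and uniqueness identifies the two.\<close>
  have "matrix_inv g ** g = mat 1"
    unfolding matrix_inv_def by (rule someI2[where a = g']) (use inv in auto)
  then have matrix_inv: "matrix_inv g = g'"
    by (metis inv matrix_mul_assoc matrix_mul_lid matrix_mul_rid)
  have det: "g \<in> SL2"
    using one by (simp add: SL2_def det_2 g_def algebra_simps)
  have conj: "g ** vector [vector [u, v], vector [v * \<omega>, u]] ** g' =
      vector [vector [u, v / d], vector [v / d * (\<omega> * d\<^sup>2), u]]" for u v
  proof -
    have "g ** vector [vector [u, v], vector [v * \<omega>, u]] =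
        vector [vector [u, v / d], vector [v / d * (\<omega> * d\<^sup>2), u]] ** g"
      using d(1)
      by (simp add: g_def matrix_matrix_mult_def vec_eq_iff forall_2 sum_2 power2_eq_square field_simps)
    then show ?thesis by (metis inv matrix_mul_assoc matrix_mul_rid)
  qed
  have "torus (\<omega> * d\<^sup>2) = (\<lambda>t. g ** t ** g') ` torus \<omega>"
  proof
    show "(\<lambda>t. g ** t ** g') ` torus \<omega> \<subseteq> torus (\<omega> * d\<^sup>2)"
    proof
      fix T assume "T \<in> (\<lambda>t. g ** t ** g') ` torus \<omega>"
      then obtain u v where T: "T = vector [vector [u, v / d], vector [v / d * (\<omega> * d\<^sup>2), u]]"
        and uv: "u\<^sup>2 - v\<^sup>2 * \<omega> = 1" by (auto simp: torus_def conj)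
      have "u\<^sup>2 - (v / d)\<^sup>2 * (\<omega> * d\<^sup>2) = 1"
        using uv d(1) by (simp add: power_divide)
      then show "T \<in> torus (\<omega> * d\<^sup>2)"
        unfolding torus_def T by blast
    qed
    show "torus (\<omega> * d\<^sup>2) \<subseteq> (\<lambda>t. g ** t ** g') ` torus \<omega>"
    proof
      fix T assume "T \<in> torus (\<omega> * d\<^sup>2)"
      then obtain u v where T: "T = vector [vector [u, v], vector [v * (\<omega> * d\<^sup>2), u]]"
        and uv: "u\<^sup>2 - v\<^sup>2 * (\<omega> * d\<^sup>2) = 1" by (auto simp: torus_def)
      have "T = g ** vector [vector [u, v * d], vector [v * d * \<omega>, u]] ** g'"
        using d(1) by (simp add: conj T)
      moreover have "vector [vector [u, v * d], vector [v * d * \<omega>, u]] \<in> torus \<omega>"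
        using uv unfolding torus_def by (force simp: power_mult_distrib algebra_simps)
      ultimately show "T \<in> (\<lambda>t. g ** t ** g') ` torus \<omega>" by blast
    qed
  qed
  then show ?thesis
    unfolding G_conjugate_def using det matrix_inv by metis
qed

context nonarch_local_field
begin

section \<open>Depth in terms of the level of the character\<close>

lemma dual_depth_eq:
  assumes res: "residue_char ord \<noteq> 2" and \<Phi>: "char_level \<Phi> M"
    and \<omega>: "uniformiser ord \<omega>" and \<beta>: "\<beta> \<noteq> 0"
  shows "dual_depth ord \<Phi> \<omega> (trace_dual (torus_elt \<beta> \<omega>)) = of_int (ord \<beta>) + 3 / 2 - of_int M"
proof -
  note two = two_unit[OF res]
  have \<omega>': "\<omega> \<noteq> 0" "ord \<omega> = 1" using \<omega> by (auto simp: uniformiser_def)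
  have pairing: "trace_dual (torus_elt \<beta> \<omega>) (torus_elt c \<omega>) = 2 * \<beta> * \<omega> * c" for c
    by (simp add: trace_dual_def sl2_def trace_def sum_2 torus_elt_def root_mat_def
        matrix_matrix_mult_def algebra_simps)
  have depth: "lie_depth ord \<omega> (torus_elt c \<omega>) = ereal (of_int (ord c) + 1 / 2)" if "c \<noteq> 0" for c
    using that \<omega>' by (simp add: lie_depth_def torus_elt_def root_mat_def ext_ord_def ord_mult
        ord_power2 field_simps)
  show ?thesis
    unfolding dual_depth_def
  proof (rule Greatest_equality)
    show "\<forall>Z\<in>torus_lie \<omega>. ereal (- (of_int (ord \<beta>) + 3 / 2 - of_int M)) < lie_depth ord \<omega> Z \<longrightarrow>
        \<Phi> (trace_dual (torus_elt \<beta> \<omega>) Z) = 1"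
    proof (intro ballI impI)
      fix Z assume "Z \<in> torus_lie \<omega>"
        and Z: "ereal (- (of_int (ord \<beta>) + 3 / 2 - of_int M)) < lie_depth ord \<omega> Z"
      then obtain c where c: "Z = torus_elt c \<omega>" by (auto simp: torus_lie_def)
      have "2 * \<beta> * \<omega> * c \<in> frac_ideal M"
      proof (cases "c = 0")
        case False
        \<comment> \<open>The half-integers cancel, and the strict inequality between integers gains
          1; with ord \<open>\<omega>\<close> = 1 this is just enough to reach p^M. So the bound is
          attained and the maximum exists.\<close>
        then have "real_of_int (M - ord \<beta> - 2) < real_of_int (ord c)"
          using Z depth[of c] c by simp
        then have "M - ord \<beta> - 1 \<le> ord c" by linarith
        then show ?thesis using two \<omega>' \<beta> False
          by (intro ord_in_frac_ideal) (simp add: ord_mult)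
      qed simp
      then show "\<Phi> (trace_dual (torus_elt \<beta> \<omega>) Z) = 1"
        by (simp add: c pairing char_level_trivial[OF \<Phi>])
    qed
  next
    fix \<rho>
    assume \<rho>: "\<forall>Z\<in>torus_lie \<omega>. ereal (- \<rho>) < lie_depth ord \<omega> Z \<longrightarrow>
        \<Phi> (trace_dual (torus_elt \<beta> \<omega>) Z) = 1"
    \<comment> \<open>Dividing a point of p^(M-1) where \<open>\<Phi>\<close> is non-trivial by 2
      \<open>\<beta>\<close> \<open>\<omega>\<close> gives a Lie algebra element of depth at least M
      - ord \<open>\<beta>\<close> - 3/2 that the character detects, which bounds every admissible
      \<open>\<rho>\<close>.\<close>
    obtain x where x: "x \<in> frac_ideal (M - 1)" "\<Phi> x \<noteq> 1"
      using \<Phi> by (auto simp: char_level_def)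
    then have "x \<noteq> 0" using char_level_trivial[OF \<Phi> frac_ideal_0] by auto
    define c where "c = x / (2 * \<beta> * \<omega>)"
    have "2 * \<beta> * \<omega> * c = x" using two \<omega>' \<beta> by (simp add: c_def)
    then have "\<Phi> (trace_dual (torus_elt \<beta> \<omega>) (torus_elt c \<omega>)) \<noteq> 1"
      using x(2) by (simp add: pairing)
    then have "\<not> ereal (- \<rho>) < lie_depth ord \<omega> (torus_elt c \<omega>)"
      using \<rho> by (auto simp: torus_lie_def)
    moreover have "c \<noteq> 0" using \<open>x \<noteq> 0\<close> two \<omega>' \<beta> by (simp add: c_def)
    ultimately have "real_of_int (ord c) + 1 / 2 \<le> - \<rho>" by (simp add: depth)
    moreover have "M - 2 - ord \<beta> \<le> ord c"
      using x(1) \<open>x \<noteq> 0\<close> two \<omega>' \<beta> by (simp add: c_def ord_divide ord_mult frac_ideal_def)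
    then have "real_of_int (M - 2 - ord \<beta>) \<le> real_of_int (ord c)" by linarith
    ultimately show "\<rho> \<le> of_int (ord \<beta>) + 3 / 2 - of_int M" by simp
  qed
qed

text \<open>
  If the two terms of the phase derivative cancel to leading order at a norm \<open>x\<close>, Hensel's lemma
  makes \<open>\<theta> / \<omega>\<close> the square of the inverse of a norm, and then the two tori are conjugate.
\<close>

lemma phase_derivative_ord:
  assumes res: "residue_char ord \<noteq> 2" and \<omega>: "uniformiser ord \<omega>" and \<theta>: "\<theta> \<noteq> 0"
    and x: "x \<noteq> 0" "x \<in> norm_group \<omega>" and not_conj: "\<not> G_conjugate (torus \<omega>) (torus \<theta>)"
  shows "\<theta> - \<omega> / x\<^sup>2 \<noteq> 0" "ord (\<theta> - \<omega> / x\<^sup>2) = min (ord \<theta>) (1 - 2 * ord x)"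
proof -
  have \<omega>': "\<omega> \<noteq> 0" "ord \<omega> = 1" using \<omega> by (auto simp: uniformiser_def)
  define g where "g = \<theta> - \<omega> / x\<^sup>2"
  define m where "m = min (ord \<theta>) (1 - 2 * ord x)"
  have v: "- (\<omega> / x\<^sup>2) \<noteq> 0" "ord (- (\<omega> / x\<^sup>2)) = 1 - 2 * ord x"
    using \<omega>' x by (simp_all add: ord_divide ord_power2)
  have "g \<noteq> 0 \<and> ord g = m"
  proof (cases "ord \<theta> = 1 - 2 * ord x")
    case False
    then consider "ord \<theta> < 1 - 2 * ord x" | "1 - 2 * ord x < ord \<theta>" by linarith
    then show ?thesis
    proof cases
      case 1
      then show ?thesis
        using ord_shell_add[OF \<theta>, of "- (\<omega> / x\<^sup>2)"] v unfolding g_def m_def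
        by (simp add: ord_in_frac_ideal del: frac_ideal_minus_iff)
    next
      case 2
      then show ?thesis
        using ord_shell_add[OF v(1), of \<theta>] v unfolding g_def m_def
        by (simp add: ord_in_frac_ideal)
    qed
  next
    case True
    have "g \<notin> frac_ideal (m + 1)"
    proof
      assume g: "g \<in> frac_ideal (m + 1)"
      \<comment> \<open>Equal valuations mean that x^2 / \<open>\<omega>\<close> has valuation -m,
        so \<open>\<theta>\<close> x^2 / \<open>\<omega>\<close> = 1 + g x^2 /
        \<open>\<omega>\<close> has a square root c congruent to 1.\<close>
      have "g * x\<^sup>2 / \<omega> \<in> frac_ideal 1"
        by (rule frac_ideal_divide[OF frac_ideal_mult[OF g ord_in_frac_ideal[OF order.refl] order.refl]])
          (use \<omega>' x True in \<open>simp_all add: ord_power2 m_def\<close>)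
      then obtain c where c: "c - 1 \<in> frac_ideal 1" "c\<^sup>2 = 1 + g * x\<^sup>2 / \<omega>"
        using square_root_near_1[OF res] by blast
      have c0: "c \<noteq> 0" "ord c = 0" using c(1) ord_shell_add[of 1 "c - 1"] by simp_all
      \<comment> \<open>As c is congruent to 1, x / c differs from the norm x by an element of
        p^(ord x + 1), hence is a norm. So d = c / x meets the conditions of
        \<open>G_conjugate_torus\<close>.\<close>
      have "x / c = x + (1 - c) * x / c" using c0 by (simp add: field_simps)
      moreover have "(1 - c) * x / c \<in> frac_ideal (ord x + 1)"
      proof (rule frac_ideal_divide[OF frac_ideal_mult[OF _ ord_in_frac_ideal[OF order.refl] order.refl]])
        show "1 - c \<in> frac_ideal 1" using c(1) frac_ideal_minus_iff[of "c - 1" 1] by simp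
      qed (use c0 in simp_all)
      ultimately have "x / c \<in> norm_group \<omega>"
        using norm_group_shift[OF res x(1) _ x(2)] by simp
      then have "inverse (c / x) \<in> norm_group \<omega>" by simp
      moreover have "g * x\<^sup>2 = \<theta> * x\<^sup>2 - \<omega>"
        using x(1) by (simp add: g_def left_diff_distrib)
      then have "\<omega> * c\<^sup>2 = \<theta> * x\<^sup>2"
        using c(2) \<omega>'(1) by (simp add: field_simps)
      then have "\<theta> = \<omega> * (c / x)\<^sup>2"
        using x(1) by (simp add: power_divide field_simps)
      ultimately show False
        using G_conjugate_torus[of "c / x" \<omega>] c0 x not_conj by simp
    qed
    moreover have "g \<in> frac_ideal m"
      using frac_ideal_add[of \<theta> m "- (\<omega> / x\<^sup>2)"] v True
      by (simp add: g_def m_def ord_in_frac_ideal del: frac_ideal_minus_iff)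
    ultimately show ?thesis by (auto simp: frac_ideal_def)
  qed
  then show "\<theta> - \<omega> / x\<^sup>2 \<noteq> 0" "ord (\<theta> - \<omega> / x\<^sup>2) = min (ord \<theta>) (1 - 2 * ord x)"
    by (simp_all add: g_def m_def)
qed

section \<open>Assembling the shells\<close>

lemma abs_val_measurable:
  assumes "normalised_haar ord \<mu>"
  shows "(\<lambda>x. inverse (abs_val ord x)) \<in> borel_measurable \<mu>"
proof -
  have "sets \<mu> = sets borel" using assms by (simp add: normalised_haar_def)
  moreover have "(\<lambda>x. dist x (0 :: 'k)) \<in> borel_measurable borel"
    by (intro borel_measurable_continuous_onI continuous_intros)
  then have "(\<lambda>x :: 'k. inverse (abs_val ord x)) \<in> borel_measurable borel"
    by (simp add: dist_abs_val)
  ultimately show ?thesis using measurable_cong_sets by blast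
qed

lemma mock_fourier_eq_0:
  assumes res: "residue_char ord \<noteq> 2" and \<mu>: "normalised_haar ord \<mu>"
    and \<psi>: "char_level (\<lambda>y. \<Phi> (\<beta> * s * y)) M"
    and \<omega>: "uniformiser ord \<omega>" and \<theta>: "\<theta> \<noteq> 0" and level: "ord \<theta> + 3 < 2 * M"
    and not_conj: "\<not> G_conjugate (torus \<omega>) (torus \<theta>)"
  shows "mock_fourier ord \<mu> \<Phi> \<omega> \<beta> s \<theta> = 0"
proof -
  have \<omega>': "\<omega> \<noteq> 0" "ord \<omega> = 1" using \<omega> by (auto simp: uniformiser_def)
  define \<psi> where "\<psi> y = \<Phi> (\<beta> * s * y)" for y
  have \<psi>: "char_level \<psi> M" using \<psi> by (simp add: \<psi>_def[abs_def])
  \<comment> \<open>The non-oscillating part of the integrand with respect to dx: the weight |x|^-1,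
    the norm condition and the Gauss sum over l.\<close>
  define h where "h x = of_real (inverse (abs_val ord x)) * indicator (norm_group \<omega>) x *
      (\<Sum>\<^sub>\<infinity>l. gauss_shell \<mu> \<psi> l x)" for x
  have h_shift: "h (x + w) = h x" if "x \<noteq> 0" "w \<in> frac_ideal (ord x + 1)" for x w
    using that ord_shell_add[OF that] gauss_shell_shift[OF res \<mu> \<psi> that]
      norm_group_shift_iff[OF res that]
    by (simp add: h_def abs_val_def indicator_def)
  have inner: "(\<Sum>\<^sub>\<infinity>l. LINT t : ord_shell ord l | \<mu>.
        \<Phi> (\<beta> * s * (x * \<theta> + inverse x * \<omega> - inverse x * t\<^sup>2)))
      = \<psi> (x * \<theta> + inverse x * \<omega>) * (\<Sum>\<^sub>\<infinity>l. gauss_shell \<mu> \<psi> l x)" for x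
  proof -
    have "\<Phi> (\<beta> * s * (x * \<theta> + inverse x * \<omega> - inverse x * t\<^sup>2))
        = \<psi> (x * \<theta> + inverse x * \<omega>) * \<psi> (- (t\<^sup>2 / x))" for t
      using char_level_add[OF \<psi>, of "x * \<theta> + inverse x * \<omega>" "- (t\<^sup>2 / x)"]
      by (simp add: \<psi>_def divide_inverse mult.commute)
    then show ?thesis
      \<comment> \<open>\<open>infsum_cmult_right'\<close> extracts the phase factor whether or not
        the series over l converges.\<close>
      by (simp add: gauss_shell_def set_lebesgue_integral_def infsum_cmult_right'
          mult.left_commute[of _ "\<psi> _"] scaleR_conv_of_real)
  qed
  have "(LINT x : ord_shell ord n | mult_haar ord \<mu>. indicator (norm_group \<omega>) x *
      (\<Sum>\<^sub>\<infinity>l. LINT t : ord_shell ord l | \<mu>.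
        \<Phi> (\<beta> * s * (x * \<theta> + inverse x * \<omega> - inverse x * t\<^sup>2)))) = 0" for n
    unfolding mult_haar_def set_lebesgue_integral_def[of "density _ _"] inner
  proof (rule integral_density_eq_0[OF abs_val_measurable[OF \<mu>]])
    \<comment> \<open>A - n is the valuation of the phase derivative on the shell. The two terms of
      the minimum add up to ord \<open>\<theta>\<close> + 1 < 2 M - 2, independently of n, so the
      smaller one is at most M - 2 on every shell.\<close>
    define A where "A = min (ord \<theta> + n) (1 - n)"
    have "integral\<^sup>L \<mu> (\<lambda>x. indicator (ord_shell ord n) x *\<^sub>R
        (h x * \<psi> (x * \<theta> + inverse x * \<omega>))) = 0"
    proof (rule nonstationary_shell_integral_eq_0[OF \<mu> \<psi> h_shift \<omega>'(1)])
      show "A \<le> M - 2" "A \<le> ord \<omega> - n" using level \<omega>' by (auto simp: A_def)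
      fix x assume x: "x \<noteq> 0" "ord x = n" "h x \<noteq> 0"
      then have "x \<in> norm_group \<omega>" by (auto simp: h_def indicator_def split: if_splits)
      then show "\<theta> - \<omega> / x\<^sup>2 \<noteq> 0 \<and> ord (\<theta> - \<omega> / x\<^sup>2) = A - n"
        using phase_derivative_ord[OF res \<omega> \<theta> x(1) _ not_conj] x(2) by (simp add: A_def min_def)
    qed
    then show "integral\<^sup>L \<mu> (\<lambda>x. inverse (abs_val ord x) *\<^sub>R (indicator (ord_shell ord n) x *\<^sub>R
        (indicator (norm_group \<omega>) x * (\<psi> (x * \<theta> + inverse x * \<omega>) *
          (\<Sum>\<^sub>\<infinity>l. gauss_shell \<mu> \<psi> l x))))) = 0"
      by (simp add: h_def scaleR_conv_of_real ac_simps)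
    show "0 \<le> inverse (abs_val ord x)" for x
      by (simp add: abs_val_def)
  qed
  then show ?thesis by (simp add: mock_fourier_def)
qed

end

theorem theorem10p1:
  fixes ord :: "'k::{field, metric_space} \<Rightarrow> int"
    and \<mu> :: "'k measure"
    and \<Phi> :: "'k \<Rightarrow> complex"
    and \<omega> \<beta> s \<theta>' :: 'k
    and X :: "'k^2^2 \<Rightarrow> 'k"
    and Y :: "'k^2^2"
  assumes "nonarch_local_field ord"
    and "residue_char ord \<noteq> 2"
    and "normalised_haar ord \<mu>"
    and "nontrivial_add_char \<Phi>"
    and "uniformiser ord \<omega>"
    and "\<beta> \<noteq> 0" and "s \<noteq> 0" and "\<theta>' \<noteq> 0"
    and "X = trace_dual (torus_elt \<beta> \<omega>)"
    and "Y = torus_elt s \<theta>'"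
    and "ereal (dual_depth ord \<Phi> \<omega> X) + lie_depth ord \<theta>' Y < 0"
    and "\<not> G_conjugate (torus \<omega>) (torus \<theta>')"
  shows "mock_fourier ord \<mu> \<Phi> \<omega> \<beta> s \<theta>' = 0"
proof -
  interpret nonarch_local_field ord by fact
  obtain M where \<Phi>: "char_level \<Phi> M"
    using char_level_exists[OF \<open>nontrivial_add_char \<Phi>\<close>] .
  have "char_level (\<lambda>y. \<Phi> (\<beta> * s * y)) (M - ord (\<beta> * s))"
    using char_level_scale[OF \<Phi>, of "\<beta> * s"] \<open>\<beta> \<noteq> 0\<close> \<open>s \<noteq> 0\<close> by simp
  moreover have "lie_depth ord \<theta>' Y = ereal (of_int (ord s) + of_int (ord \<theta>') / 2)"
    using \<open>s \<noteq> 0\<close> \<open>\<theta>' \<noteq> 0\<close>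
    by (simp add: \<open>Y = _\<close> lie_depth_def torus_elt_def root_mat_def ext_ord_def ord_mult
        ord_power2 field_simps)
  then have "of_int (ord \<beta>) + 3 / 2 - of_int M + (of_int (ord s) + of_int (ord \<theta>') / 2) < (0 :: real)"
    using assms(11) dual_depth_eq[OF \<open>residue_char ord \<noteq> 2\<close> \<Phi> \<open>uniformiser ord \<omega>\<close> \<open>\<beta> \<noteq> 0\<close>]
    by (simp add: \<open>X = _\<close>)
  \<comment> \<open>Doubling the depth inequality clears the halves; M - ord(\<open>\<beta>\<close>
    s) is the level of the rescaled character.\<close>
  then have "ord \<theta>' + 3 < 2 * (M - ord (\<beta> * s))"
    using \<open>\<beta> \<noteq> 0\<close> \<open>s \<noteq> 0\<close> by (simp add: ord_mult)
  ultimately show ?thesis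
    using mock_fourier_eq_0 assms by blast
qed

end
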